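(* Let $m,n$ be positive integers and let $\sigma(1),\dots,\sigma(m)$ be i.i.d. random variables with values in $[n]=\{1,\dots,n\}$ (with an arbitrary common distribution). For each $j\in[n]$ let $0=a_0(j)<a_1(j)<\cdots<a_{k_j}(j)=m+1$ be a sequence of integers, let $B_j=|\{i\in[m]:\sigma(i)=j\}|$, and let $\mathbf x_j\in\{0,1,\dots,k_j-1\}$ be defined by $$\mathbf x_j=t\quad\text{iff}\quad a_t(j)\le B_j<a_{t+1}(j).$$ Then the law of $(\mathbf x_1,\dots,\mathbf x_n)$, a probability measure on $\prod_{j=1}^n\{0,\dots,k_j-1\}$, is conditionally negatively associated.
   Context: $[m]=\{1,\dots,m\}$. Let $\Omega=\prod_{i=1}^n\Omega_i$ be a finite product of finite chains (totally ordered sets), with the product order (here $\Omega_j=\{0,\dots,k_j-1\}$ with its usual order). An event $\mathcal A\subseteq\Omega$ is increasing if $x\ge y\in\mathcal A$ implies $x\in\mathcal A$. A coordinate $i$ affects $\mathcal A$ if there are $\eta\in\mathcal A$ and $\tau\in\Omega\setminus\mathcal A$ with $\eta_j=\tau_j$ for all $j\ne i$; write $\mathcal A\perp\mathcal B$ if no coordinate affects both $\mathcal A$ and $\mathcal B$. A probability measure $\mu$ on $\Omega$ is negatively associated (NA) if $\mu(\mathcal A\cap\mathcal B)\le\mu(\mathcal A)\mu(\mathcal B)$ whenever $\mathcal A,\mathcal B$ are increasing and $\mathcal A\perp\mathcal B$. It is conditionally negatively associated (CNA) if every measure obtained from $\mu$ by conditioning on the values of some (possibly none) of the coordinate variables is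 NA; only conditioning events of positive probability are considered. *)

theory Defs
  imports "HOL-Probability.Probability"
begin

text \<open>
  A finite product of finite chains is \<^term>\<open>PiE I S\<close> for a finite index set \<open>I\<close> and finite
  subsets \<open>S i\<close> of a linearly ordered type.
\<close>

definition increasing_event ::
    "'i set \<Rightarrow> ('i \<Rightarrow> 'a::linorder set) \<Rightarrow> ('i \<Rightarrow> 'a) set \<Rightarrow> bool" where
  "increasing_event I S A \<longleftrightarrow>
     A \<subseteq> PiE I S \<and> (\<forall>y\<in>A. \<forall>x\<in>PiE I S. (\<forall>i\<in>I. y i \<le> x i) \<longrightarrow> x \<in> A)"

definition affects ::
    "'i set \<Rightarrow> ('i \<Rightarrow> 'a set) \<Rightarrow> 'i \<Rightarrow> ('i \<Rightarrow> 'a) set \<Rightarrow> bool" where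
  "affects I S i A \<longleftrightarrow> (\<exists>\<eta>\<in>A. \<exists>\<tau>\<in>PiE I S - A. \<forall>j\<in>I - {i}. \<eta> j = \<tau> j)"

definition perp_events ::
    "'i set \<Rightarrow> ('i \<Rightarrow> 'a set) \<Rightarrow> ('i \<Rightarrow> 'a) set \<Rightarrow> ('i \<Rightarrow> 'a) set \<Rightarrow> bool" where
  "perp_events I S A B \<longleftrightarrow> \<not> (\<exists>i\<in>I. affects I S i A \<and> affects I S i B)"

definition prob_measure_on :: "'b set \<Rightarrow> 'b measure \<Rightarrow> bool" where
  "prob_measure_on \<Omega> \<mu> \<longleftrightarrow> prob_space \<mu> \<and> space \<mu> = \<Omega> \<and> sets \<mu> = Pow \<Omega>"

definition negatively_associated ::
    "'i set \<Rightarrow> ('i \<Rightarrow> 'a::linorder set) \<Rightarrow> ('i \<Rightarrow> 'a) measure \<Rightarrow> bool" where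
  "negatively_associated I S \<mu> \<longleftrightarrow>
     prob_measure_on (PiE I S) \<mu> \<and>
     (\<forall>A B. increasing_event I S A \<longrightarrow> increasing_event I S B \<longrightarrow> perp_events I S A B \<longrightarrow>
        measure \<mu> (A \<inter> B) \<le> measure \<mu> A * measure \<mu> B)"

text \<open>
  For an event \<open>E\<close> of positive probability, \<^term>\<open>uniform_measure \<mu> E\<close> is the conditional measure
  \<open>F \<mapsto> \<mu> (E \<inter> F) / \<mu> E\<close>; no uniformity of \<open>\<mu>\<close> is involved.
\<close>

definition conditionally_negatively_associated ::
    "'i set \<Rightarrow> ('i \<Rightarrow> 'a::linorder set) \<Rightarrow> ('i \<Rightarrow> 'a) measure \<Rightarrow> bool" where
  "conditionally_negatively_associated I S \<mu> \<longleftrightarrow>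
     prob_measure_on (PiE I S) \<mu> \<and>
     (\<forall>J v. J \<subseteq> I \<longrightarrow> measure \<mu> {x\<in>PiE I S. \<forall>j\<in>J. x j = v j} > 0 \<longrightarrow>
        negatively_associated I S (uniform_measure \<mu> {x\<in>PiE I S. \<forall>j\<in>J. x j = v j}))"

end

theory Submission
  imports Defs
begin

text \<open>
  The vector of counts \<open>B\<close> has weight \<open>m! \<Prod>\<^sub>j p\<^sub>j\<^bsup>b\<^sub>j\<^esup> / b\<^sub>j!\<close> on the slice \<open>\<Sum>\<^sub>j b\<^sub>j = m\<close>. Fixing some
  of the \<open>x\<^sub>j\<close> confines the corresponding \<open>B\<^sub>j\<close> to intervals, so conditionally \<open>B\<close> is still
  distributed as independent integer variables with log-concave weights, conditioned on their sum.
  By Efron's theorem, the conditional mean of an increasing function of such variables given their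
  sum increases with the sum. For increasing events \<open>U \<bottom> V\<close>, split the coordinates into those
  affecting \<open>U\<close> and the rest: given the sum \<open>s\<close> of the first block, \<open>U\<close> and \<open>V\<close> are independent,
  with the probability of \<open>U\<close> increasing and that of \<open>V\<close> decreasing in \<open>s\<close>, and Chebyshev's sum
  inequality applies.
\<close>

section \<open>Log-concave sequences and their convolutions\<close>

text \<open>By the Binet-Cauchy identity, twice the difference of the two sides is the sum over all
  pairs \<open>x\<close>, \<open>y\<close> of a 2x2 minor of \<open>p\<close>, \<open>q\<close>
  times one of \<open>r\<close>, \<open>t\<close>, and the hypotheses give both minors the same
  sign. Chebyshev's sum inequality is an instance.\<close>

lemma sum_mult_sum_rearrange:
  fixes p q r t :: "'a::linorder \<Rightarrow> real"
  assumes "finite X"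
    and pq: "\<And>x y. x \<in> X \<Longrightarrow> y \<in> X \<Longrightarrow> x < y \<Longrightarrow> p y * q x \<le> p x * q y"
    and rt: "\<And>x y. x \<in> X \<Longrightarrow> y \<in> X \<Longrightarrow> x < y \<Longrightarrow> r y * t x \<le> r x * t y"
  shows "(\<Sum>x\<in>X. p x * t x) * (\<Sum>x\<in>X. q x * r x) \<le> (\<Sum>x\<in>X. p x * r x) * (\<Sum>x\<in>X. q x * t x)"
proof -
  let ?d = "(\<Sum>x\<in>X. p x * r x) * (\<Sum>x\<in>X. q x * t x) - (\<Sum>x\<in>X. p x * t x) * (\<Sum>x\<in>X. q x * r x)"
  have d: "?d = (\<Sum>x\<in>X. \<Sum>y\<in>X. p x * r x * (q y * t y) - p x * t x * (q y * r y))"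
    by (simp add: sum_product sum_subtractf)
  have "2 * ?d = (\<Sum>x\<in>X. \<Sum>y\<in>X. p x * r x * (q y * t y) - p x * t x * (q y * r y))
               + (\<Sum>x\<in>X. \<Sum>y\<in>X. p y * r y * (q x * t x) - p y * t y * (q x * r x))"
    unfolding d by (subst (3) sum.swap) simp
  also have "\<dots> = (\<Sum>x\<in>X. \<Sum>y\<in>X. (p x * q y - p y * q x) * (r x * t y - r y * t x))"
    by (simp add: sum.distrib[symmetric] algebra_simps)
  also have "\<dots> \<ge> 0"
  proof (intro sum_nonneg)
    fix x y assume xy: "x \<in> X" "y \<in> X"
    show "0 \<le> (p x * q y - p y * q x) * (r x * t y - r y * t x)"
    proof (cases x y rule: linorder_cases)
      case less
      then show ?thesis using pq[of x y] rt[of x y] xy by simp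
    next
      case equal
      then show ?thesis by simp
    next
      case greater
      then show ?thesis using pq[of y x] rt[of y x] xy by (intro mult_nonpos_nonpos) auto
    qed
  qed
  finally show ?thesis by simp
qed

text \<open>Together with nonnegativity, the inequality rules out internal zeros.\<close>

definition log_concave :: "(int \<Rightarrow> real) \<Rightarrow> bool" where
  "log_concave w \<longleftrightarrow> (\<forall>i. 0 \<le> w i) \<and> (\<forall>i j. i \<le> j \<longrightarrow> w i * w (j + 1) \<le> w (i + 1) * w j)"

lemma log_concaveI:
  assumes "\<And>i. 0 \<le> w i" "\<And>i j. i \<le> j \<Longrightarrow> w i * w (j + 1) \<le> w (i + 1) * w j"
  shows "log_concave w"
  using assms by (auto simp: log_concave_def)

lemma log_concave_nonneg: "log_concave w \<Longrightarrow> 0 \<le> w i"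
  by (simp add: log_concave_def)

lemma log_concave_step: "log_concave w \<Longrightarrow> i \<le> j \<Longrightarrow> w i * w (j + 1) \<le> w (i + 1) * w j"
  by (simp add: log_concave_def)

text \<open>Each induction step moves one unit from the larger argument to the smaller. For
  \<open>i = j\<close> the two sides coincide; otherwise \<open>i + 1 \<le> j\<close>, as the
  induction hypothesis requires.\<close>

lemma log_concave_shift:
  assumes lc: "log_concave w" and ij: "i \<le> j"
  shows "w i * w (j + int d) \<le> w (i + int d) * w j"
  using ij
proof (induction d arbitrary: i)
  case 0
  then show ?case by simp
next
  case (Suc d)
  show ?case
  proof (cases "i = j")
    case True
    then show ?thesis by simp
  next
    case False
    then have "w i * w ((j + int d) + 1) \<le> w (i + 1) * w (j + int d)"
      using Suc.prems by (intro log_concave_step[OF lc]) simp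
    also have "\<dots> \<le> w (i + 1 + int d) * w j"
      using Suc.prems False by (intro Suc.IH) simp
    finally show ?thesis by (simp add: algebra_simps)
  qed
qed

text \<open>The window contains the supports of \<open>h\<close> and of its translate, so shifting
  the variable leaves no boundary terms.\<close>

lemma sum_int_interval_shift:
  fixes h :: "int \<Rightarrow> real"
  assumes "\<And>x. x \<notin> {0..L} \<Longrightarrow> h x = 0"
  shows "(\<Sum>x\<in>{-1..L+1}. h (x - 1)) = (\<Sum>x\<in>{-1..L+1}. h x)"
proof -
  have "(\<Sum>x\<in>{-1..L+1}. h (x - 1)) = (\<Sum>x\<in>{1..L+1}. h (x - 1))"
    using assms by (intro sum.mono_neutral_right) auto
  also have "\<dots> = (\<Sum>x\<in>{0..L}. h x)"
    by (rule sum.reindex_bij_witness[where i="\<lambda>x. x + 1" and j="\<lambda>x. x - 1"]) auto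
  also have "\<dots> = (\<Sum>x\<in>{-1..L+1}. h x)"
    using assms by (intro sum.mono_neutral_left) auto
  finally show ?thesis .
qed

text \<open>Shifting the variable in the sums at \<open>s\<close> and \<open>t\<close> leaves four
  sums pairing the weights \<open>v (s + 1 - x)\<close>, \<open>v (t + 1 - x)\<close> with
  \<open>u x\<close>, \<open>u (x - 1)\<close>. Log-concavity of \<open>v\<close> and of
  \<open>u\<close> gives the two hypotheses of the rearrangement inequality.\<close>

lemma log_concave_convolution:
  assumes u: "log_concave u" and v: "log_concave v" and u0: "\<And>x. x \<notin> {0..L} \<Longrightarrow> u x = 0"
  shows "log_concave (\<lambda>s. \<Sum>x\<in>{0..L}. u x * v (s - x))"
proof (rule log_concaveI)
  show "0 \<le> (\<Sum>x\<in>{0..L}. u x * v (i - x))" for i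
    by (intro sum_nonneg mult_nonneg_nonneg log_concave_nonneg[OF u] log_concave_nonneg[OF v])
next
  fix s t :: int assume st: "s \<le> t"
  have ext: "(\<Sum>x\<in>{0..L}. u x * v (s - x)) = (\<Sum>x\<in>{-1..L+1}. v (s - x) * u x)" for s
    using u0 by (subst mult.commute, intro sum.mono_neutral_left) auto
  have sh: "(\<Sum>x\<in>{-1..L+1}. v (s - x) * u x) = (\<Sum>x\<in>{-1..L+1}. v (s + 1 - x) * u (x - 1))" for s
    using sum_int_interval_shift[of L "\<lambda>x. v (s - x) * u x"] u0 by (simp add: algebra_simps)
  have "(\<Sum>x\<in>{-1..L+1}. v (s + 1 - x) * u (x - 1)) * (\<Sum>x\<in>{-1..L+1}. v (t + 1 - x) * u x)
     \<le> (\<Sum>x\<in>{-1..L+1}. v (s + 1 - x) * u x) * (\<Sum>x\<in>{-1..L+1}. v (t + 1 - x) * u (x - 1))"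
  proof (rule sum_mult_sum_rearrange)
    fix x y :: int assume "x < y"
    then show "v (s + 1 - y) * v (t + 1 - x) \<le> v (s + 1 - x) * v (t + 1 - y)"
      using log_concave_shift[OF v, of "s + 1 - y" "t + 1 - y" "nat (y - x)"] st
      by (simp add: algebra_simps)
    show "u y * u (x - 1) \<le> u x * u (y - 1)"
      using log_concave_step[OF u, of "x - 1" "y - 1"] \<open>x < y\<close> by (simp add: algebra_simps)
  qed simp
  then show "(\<Sum>x\<in>{0..L}. u x * v (s - x)) * (\<Sum>x\<in>{0..L}. u x * v (t + 1 - x))
     \<le> (\<Sum>x\<in>{0..L}. u x * v (s + 1 - x)) * (\<Sum>x\<in>{0..L}. u x * v (t - x))"
    unfolding ext using sh[of s] sh[of t] by simp
qed

section \<open>Efron's theorem for two summands\<close>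

text \<open>A monotone coupling: for independent \<open>X, Y\<close> with weights \<open>u, v\<close>, the law of \<open>(X, Y)\<close> given
  \<open>X + Y = s\<close> is moved to the law given \<open>X + Y = s + 1\<close> by increasing the first coordinate of
  \<open>(x, s - x)\<close> with mass \<open>f x\<close> and the second with mass \<open>g x\<close>. Log-concavity of \<open>v\<close> gives
  \<open>f \<ge> 0\<close>, that of \<open>u\<close> gives \<open>g \<ge> 0\<close>.\<close>

lemma efron_two_summands:
  fixes \<phi> :: "int \<Rightarrow> int \<Rightarrow> real"
  assumes u: "log_concave u" and v: "log_concave v" and u0: "\<And>x. x \<notin> {0..L} \<Longrightarrow> u x = 0"
    and \<phi>1: "\<And>x r. \<phi> x r \<le> \<phi> (x + 1) r"
    and \<phi>2: "\<And>x r. v r > 0 \<Longrightarrow> v (r + 1) > 0 \<Longrightarrow> \<phi> x r \<le> \<phi> x (r + 1)"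
  shows "(\<Sum>x\<in>{0..L}. u x * v (s - x) * \<phi> x (s - x)) * (\<Sum>x\<in>{0..L}. u x * v (s + 1 - x))
       \<le> (\<Sum>x\<in>{0..L}. u x * v (s + 1 - x) * \<phi> x (s + 1 - x)) * (\<Sum>x\<in>{0..L}. u x * v (s - x))"
proof -
  define X where "X = {-1..L+1}"
  have finX: "finite X" by (simp add: X_def)
  \<comment> \<open>\<open>N s\<close> is the total mass of slice \<open>s\<close>, and
    \<open>c s\<close> its cumulative mass in the first coordinate. Cross-multiplying by
    \<open>N\<close> avoids division: \<open>f x\<close> is the surplus that has to leave the points
    up to \<open>x\<close> on the way from \<open>s\<close> to \<open>s + 1\<close>, and
    \<open>g x\<close> is what remains of the mass at \<open>x\<close>.\<close>
  define N where "N s = (\<Sum>x\<in>X. u x * v (s - x))" for s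
  define c where "c s z = (\<Sum>x\<in>X. u x * v (s - x) * of_bool (x \<le> z))" for s z
  define f where "f x = c s x * N (s + 1) - c (s + 1) x * N s" for x
  define g where "g x = u x * v (s - x) * N (s + 1) - f x" for x
  note nn = log_concave_nonneg[OF u] log_concave_nonneg[OF v]
  have ext: "(\<Sum>x\<in>{0..L}. u x * h x) = (\<Sum>x\<in>X. u x * h x)" for h
    unfolding X_def using u0 by (intro sum.mono_neutral_left) auto
  have cdiff: "c s x = c s (x - 1) + u x * v (s - x)" if "x \<in> X" for s x
  proof -
    have "c s x = (\<Sum>y\<in>X. u y * v (s - y) * of_bool (y \<le> x - 1) + (if y = x then u x * v (s - x) else 0))"
      unfolding c_def by (intro sum.cong) auto
    then show ?thesis using that finX by (simp add: sum.distrib c_def)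
  qed
  have clow: "c s z = 0" if "z < 0" for s z
    unfolding c_def using that u0 by (intro sum.neutral) auto
  have chigh: "c s z = N s" if "z \<ge> L" for s z
    unfolding c_def N_def using that u0 by (intro sum.cong) (auto simp: not_le)
  have f0: "f x = 0" if "x \<notin> {0..L}" for x
    using that clow[of x] chigh[of x] by (auto simp: f_def not_le)
  \<comment> \<open>The first coordinate is stochastically smaller given \<open>s\<close> than given
    \<open>s + 1\<close>; indicators of the points up to \<open>z\<close> serve as test
    functions.\<close>
  have fpos: "f z \<ge> 0" for z
  proof -
    have "(\<Sum>x\<in>X. u x * v (s - x) * 1) * (\<Sum>x\<in>X. u x * v (s + 1 - x) * of_bool (x \<le> z))
        \<le> (\<Sum>x\<in>X. u x * v (s - x) * of_bool (x \<le> z)) * (\<Sum>x\<in>X. u x * v (s + 1 - x) * 1)"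
    proof (rule sum_mult_sum_rearrange[OF finX])
      fix x y :: int assume xy: "x < y"
      have "(u x * u y) * (v (s - y) * v (s - x + 1)) \<le> (u x * u y) * (v (s - y + 1) * v (s - x))"
        using xy by (intro mult_left_mono log_concave_step[OF v] mult_nonneg_nonneg nn) simp
      then show "u y * v (s - y) * (u x * v (s + 1 - x)) \<le> u x * v (s - x) * (u y * v (s + 1 - y))"
        by (simp add: algebra_simps)
    qed auto
    then show ?thesis by (simp add: f_def c_def N_def mult.commute)
  qed
  \<comment> \<open>Conversely, one plus the first coordinate given \<open>s\<close> dominates the
    first coordinate given \<open>s + 1\<close>; hence the shifted weights
    \<open>u (x - 1)\<close>.\<close>
  have gpos: "g z \<ge> 0" if "z \<in> X" for z
  proof -
    have sh1: "(\<Sum>x\<in>X. u (x - 1) * v (s + 1 - x) * of_bool (x \<le> z)) = c s (z - 1)"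
      using sum_int_interval_shift[of L "\<lambda>x. u x * v (s - x) * of_bool (x \<le> z - 1)"] u0
      by (simp add: X_def c_def algebra_simps)
    have sh2: "(\<Sum>x\<in>X. u (x - 1) * v (s + 1 - x) * 1) = N s"
      using sum_int_interval_shift[of L "\<lambda>x. u x * v (s - x)"] u0
      by (simp add: X_def N_def algebra_simps)
    have "(\<Sum>x\<in>X. u x * v (s + 1 - x) * 1) * (\<Sum>x\<in>X. u (x - 1) * v (s + 1 - x) * of_bool (x \<le> z))
        \<le> (\<Sum>x\<in>X. u x * v (s + 1 - x) * of_bool (x \<le> z)) * (\<Sum>x\<in>X. u (x - 1) * v (s + 1 - x) * 1)"
    proof (rule sum_mult_sum_rearrange[OF finX])
      fix x y :: int assume xy: "x < y"
      have "(v (s + 1 - x) * v (s + 1 - y)) * (u (x - 1) * u (y - 1 + 1))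
          \<le> (v (s + 1 - x) * v (s + 1 - y)) * (u (x - 1 + 1) * u (y - 1))"
        using xy by (intro mult_left_mono log_concave_step[OF u] mult_nonneg_nonneg nn) simp
      then show "u y * v (s + 1 - y) * (u (x - 1) * v (s + 1 - x))
          \<le> u x * v (s + 1 - x) * (u (y - 1) * v (s + 1 - y))"
        by (simp add: algebra_simps)
    qed auto
    then have "N (s + 1) * c s (z - 1) \<le> c (s + 1) z * N s"
      unfolding sh1 sh2 by (simp add: N_def c_def)
    then show ?thesis
      using cdiff[OF that, of s] by (simp add: g_def f_def algebra_simps)
  qed
  \<comment> \<open>Mass reaches \<open>(x, s + 1 - x)\<close> from \<open>(x, s - x)\<close> and
    from \<open>(x - 1, s + 1 - x)\<close>.\<close>
  have inflow: "u x * v (s + 1 - x) * N s = g x + f (x - 1)" if "x \<in> X" for x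
    using cdiff[OF that, of s] cdiff[OF that, of "s + 1"]
    by (simp add: g_def f_def algebra_simps)
  have outflow: "u x * v (s - x) * N (s + 1) = g x + f x" for x
    by (simp add: g_def)
  have g\<phi>: "g x * \<phi> x (s - x) \<le> g x * \<phi> x (s + 1 - x)" if x: "x \<in> X" for x
  proof (cases "g x = 0")
    case False
    then have "g x > 0" using gpos[OF x] by simp
    \<comment> \<open>Where \<open>g\<close> moves mass, both values of \<open>v\<close> are
      positive, so \<open>\<phi>2\<close> is applied only under its side conditions.\<close>
    then have "u x * v (s + 1 - x) * N s > 0" "u x * v (s - x) * N (s + 1) > 0"
      using fpos[of x] fpos[of "x - 1"] by (auto simp: inflow[OF x] outflow)
    then have "v (s + 1 - x) \<noteq> 0" "v (s - x) \<noteq> 0" by auto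
    then have "v (s - x + 1) > 0" "v (s - x) > 0"
      using nn(2)[of "s + 1 - x"] nn(2)[of "s - x"] by (auto simp: less_le algebra_simps)
    then show ?thesis
      using \<phi>2[of "s - x" x] \<open>g x > 0\<close> by (simp add: algebra_simps)
  qed simp
  have "(\<Sum>x\<in>X. u x * (v (s - x) * \<phi> x (s - x))) * N (s + 1)
      = (\<Sum>x\<in>X. g x * \<phi> x (s - x) + f x * \<phi> x (s - x))"
    unfolding sum_distrib_right
    by (intro sum.cong refl) (metis outflow distrib_right mult.commute mult.assoc)
  also have "\<dots> \<le> (\<Sum>x\<in>X. g x * \<phi> x (s + 1 - x) + f x * \<phi> (x + 1) (s - x))"
    by (intro sum_mono add_mono g\<phi> mult_left_mono fpos \<phi>1)
  also have "\<dots> = (\<Sum>x\<in>X. g x * \<phi> x (s + 1 - x)) + (\<Sum>x\<in>X. f (x - 1) * \<phi> x (s + 1 - x))"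
    using sum_int_interval_shift[of L "\<lambda>x. f x * \<phi> (x + 1) (s - x)"] f0
    by (simp add: sum.distrib X_def algebra_simps)
  also have "\<dots> = (\<Sum>x\<in>X. (g x + f (x - 1)) * \<phi> x (s + 1 - x))"
    by (simp add: sum.distrib distrib_right)
  also have "\<dots> = (\<Sum>x\<in>X. u x * (v (s + 1 - x) * \<phi> x (s + 1 - x))) * N s"
    unfolding sum_distrib_right
    by (intro sum.cong refl) (simp add: inflow[symmetric] mult_ac)
  finally show ?thesis
    using ext by (simp add: N_def mult.assoc)
qed

section \<open>Sums over slices of fixed coordinate sum\<close>

text \<open>Up to normalization, the mean of \<open>f\<close> over independent variables with weights \<open>w i\<close>
  on \<open>{0..L}\<close>, conditioned on their sum being \<open>s\<close>.\<close>

definition slice_sum ::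
    "int \<Rightarrow> ('i \<Rightarrow> int \<Rightarrow> real) \<Rightarrow> 'i set \<Rightarrow> (('i \<Rightarrow> int) \<Rightarrow> real) \<Rightarrow> int \<Rightarrow> real" where
  "slice_sum L w I f s =
     (\<Sum>b\<in>PiE I (\<lambda>_. {0..L}). if sum b I = s then (\<Prod>i\<in>I. w i (b i)) * f b else 0)"

lemma slice_sum_empty: "slice_sum L w {} f s = (if s = 0 then f (\<lambda>_. undefined) else 0)"
  by (auto simp: slice_sum_def)

lemma prod_log_concave_nonneg:
  "(\<And>i. i \<in> I \<Longrightarrow> log_concave (w i)) \<Longrightarrow> 0 \<le> (\<Prod>i\<in>I. w i (b i))"
  by (intro prod_nonneg ballI log_concave_nonneg)

lemma slice_sum_mono:
  assumes "\<And>i. i \<in> I \<Longrightarrow> log_concave (w i)" "\<And>b. f b \<le> g b"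
  shows "slice_sum L w I f s \<le> slice_sum L w I g s"
  unfolding slice_sum_def using assms
  by (intro sum_mono) (auto intro!: mult_left_mono prod_log_concave_nonneg)

text \<open>The weights are nonnegative, so a vanishing total forces every weight on the slice to
  vanish. This justifies conditional means on empty slices, where division by zero gives 0.\<close>

lemma slice_sum_eq_0:
  assumes I: "finite I" and lc: "\<And>i. i \<in> I \<Longrightarrow> log_concave (w i)"
    and 0: "slice_sum L w I (\<lambda>_. 1) s = 0"
  shows "slice_sum L w I f s = 0"
proof -
  have fin: "finite (PiE I (\<lambda>_. {0..L}))" using I by (intro finite_PiE) auto
  have "\<forall>b\<in>PiE I (\<lambda>_. {0..L}). (if sum b I = s then (\<Prod>i\<in>I. w i (b i)) * 1 else 0) = 0"
    using 0 unfolding slice_sum_def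
    by (subst (asm) sum_nonneg_eq_0_iff[OF fin])
       (auto intro!: prod_log_concave_nonneg lc)
  then show ?thesis unfolding slice_sum_def by (intro sum.neutral) auto
qed

text \<open>Fixing coordinate \<open>i\<close> at \<open>x\<close> leaves the sum
  \<open>s - x\<close> to the others; inductions over the index set rest on this.\<close>

lemma slice_sum_insert:
  assumes "finite I" "i \<notin> I"
  shows "slice_sum L w (insert i I) f s =
    (\<Sum>x\<in>{0..L}. w i x * slice_sum L w I (\<lambda>b. f (b(i := x))) (s - x))"
proof -
  let ?P = "PiE I (\<lambda>_. {0..L})"
  have inj: "inj_on (\<lambda>(y, g). g(i := y)) ({0..L} \<times> ?P)"
    using inj_combinator[of i I "\<lambda>_. {0..L}"] assms by simp
  have upd: "sum (b(i := x)) I = sum b I" "(\<Prod>j\<in>I. w j ((b(i := x)) j)) = (\<Prod>j\<in>I. w j (b j))" for b x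
    using assms by (auto intro!: sum.cong prod.cong)
  have "slice_sum L w (insert i I) f s = (\<Sum>(x, b)\<in>{0..L} \<times> ?P.
      if x + sum b I = s then w i x * (\<Prod>j\<in>I. w j (b j)) * f (b(i := x)) else 0)"
    unfolding slice_sum_def PiE_insert_eq sum.reindex[OF inj] using assms
    by (intro sum.cong) (auto simp: upd fun_upd_same simp del: fun_upd_apply)
  also have "\<dots> = (\<Sum>x\<in>{0..L}. w i x * slice_sum L w I (\<lambda>b. f (b(i := x))) (s - x))"
    unfolding slice_sum_def sum_distrib_left sum.cartesian_product[symmetric]
    by (intro sum.cong) auto
  finally show ?thesis .
qed

text \<open>Once the sum \<open>x\<close> of the \<open>I\<close>-block is fixed, the two blocks
  vary independently, so the slice sum is a convolution. Block sums are nonnegative, which confines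
  \<open>x\<close> to \<open>{0..s}\<close>.\<close>

lemma slice_sum_Un:
  assumes fin: "finite I" "finite J" and disj: "I \<inter> J = {}"
    and f: "\<And>b b'. (\<And>i. i \<in> I \<Longrightarrow> b i = b' i) \<Longrightarrow> f b = f b'"
    and g: "\<And>b b'. (\<And>i. i \<in> J \<Longrightarrow> b i = b' i) \<Longrightarrow> g b = g b'"
  shows "slice_sum L w (I \<union> J) (\<lambda>b. f b * g b) s =
    (\<Sum>x\<in>{0..s}. slice_sum L w I f x * slice_sum L w J g (s - x))"
proof -
  let ?P = "PiE I (\<lambda>_. {0..L})" and ?Q = "PiE J (\<lambda>_. {0..L})"
  let ?W = "\<lambda>I b. \<Prod>i\<in>I. w i (b i)"
  have finP: "finite ?P" "finite ?Q" using fin by (auto intro!: finite_PiE)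
  \<comment> \<open>Gluing of two block vectors; the value \<open>undefined\<close> off both blocks
    keeps the result extensional.\<close>
  define mrg where "mrg = (\<lambda>(b, c) i. if i \<in> I then b i else if i \<in> J then c i else (undefined::int))"
  have mI: "mrg (b, c) i = b i" if "i \<in> I" for b c i using that by (simp add: mrg_def)
  have mJ: "mrg (b, c) i = c i" if "i \<in> J" for b c i using that disj by (auto simp: mrg_def)
  have mr: "mrg (restrict b I, restrict b J) = b" if "b \<in> PiE (I \<union> J) (\<lambda>_. {0..L})" for b
    using that by (auto simp: mrg_def PiE_iff extensional_def fun_eq_iff)
  have sums: "sum (mrg (b, c)) (I \<union> J) = sum b I + sum c J"
             "?W (I \<union> J) (mrg (b, c)) = ?W I b * ?W J c"
             "f (mrg (b, c)) = f b" "g (mrg (b, c)) = g c" for b c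
    using fin disj by (auto simp: sum.union_disjoint prod.union_disjoint mI mJ intro!: f g)
  have "slice_sum L w (I \<union> J) (\<lambda>b. f b * g b) s = (\<Sum>d\<in>?P \<times> ?Q.
      if sum (mrg d) (I \<union> J) = s then ?W (I \<union> J) (mrg d) * (f (mrg d) * g (mrg d)) else 0)"
    unfolding slice_sum_def
  proof (rule sum.reindex_bij_witness[where i=mrg and j="\<lambda>b. (restrict b I, restrict b J)"])
    fix d assume d: "d \<in> ?P \<times> ?Q"
    then show "(restrict (mrg d) I, restrict (mrg d) J) = d"
      using disj by (cases d) (auto simp: mrg_def PiE_iff extensional_def fun_eq_iff)
    show "mrg d \<in> PiE (I \<union> J) (\<lambda>_. {0..L})"
      using d by (cases d) (auto simp: mrg_def PiE_iff extensional_def)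
  qed (auto simp: mr)
  also have "\<dots> = (\<Sum>(b, c)\<in>?P \<times> ?Q.
      if sum b I + sum c J = s then ?W I b * f b * (?W J c * g c) else 0)"
    by (intro sum.cong) (auto simp: sums)
  \<comment> \<open>The condition that the block sums add up to \<open>s\<close> becomes a sum over
    the value \<open>x\<close> of the first, so that the two factors separate.\<close>
  also have "\<dots> = (\<Sum>b\<in>?P. \<Sum>c\<in>?Q. \<Sum>x\<in>{0..s}.
      (if sum b I = x then ?W I b * f b else 0) * (if sum c J = s - x then ?W J c * g c else 0))"
    unfolding sum.cartesian_product[symmetric]
  proof (intro sum.cong refl)
    fix b c assume b: "b \<in> ?P" and c: "c \<in> ?Q"
    have nn: "0 \<le> sum b I" "0 \<le> sum c J" using b c by (auto intro!: sum_nonneg)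
    have "(\<Sum>x\<in>{0..s}. (if sum b I = x then ?W I b * f b else 0) * (if sum c J = s - x then ?W J c * g c else 0))
       = (\<Sum>x\<in>{0..s}. if x = sum b I then (?W I b * f b) * (if sum c J = s - sum b I then ?W J c * g c else 0) else 0)"
      by (intro sum.cong) auto
    also have "\<dots> = (if sum b I + sum c J = s then ?W I b * f b * (?W J c * g c) else 0)"
      using nn by (subst sum.delta) auto
    finally show "(if sum b I + sum c J = s then ?W I b * f b * (?W J c * g c) else 0) =
      (\<Sum>x\<in>{0..s}. (if sum b I = x then ?W I b * f b else 0) * (if sum c J = s - x then ?W J c * g c else 0))" ..
  qed
  also have "\<dots> = (\<Sum>b\<in>?P. \<Sum>x\<in>{0..s}. \<Sum>c\<in>?Q.
      (if sum b I = x then ?W I b * f b else 0) * (if sum c J = s - x then ?W J c * g c else 0))"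
    by (intro sum.cong refl sum.swap)
  also have "\<dots> = (\<Sum>x\<in>{0..s}. \<Sum>b\<in>?P. \<Sum>c\<in>?Q.
      (if sum b I = x then ?W I b * f b else 0) * (if sum c J = s - x then ?W J c * g c else 0))"
    by (rule sum.swap)
  also have "\<dots> = (\<Sum>x\<in>{0..s}. slice_sum L w I f x * slice_sum L w J g (s - x))"
    unfolding slice_sum_def sum_product ..
  finally show ?thesis .
qed

lemma log_concave_slice_sum:
  assumes "finite I" "\<And>i. i \<in> I \<Longrightarrow> log_concave (w i)"
    "\<And>i x. i \<in> I \<Longrightarrow> x \<notin> {0..L} \<Longrightarrow> w i x = 0"
  shows "log_concave (slice_sum L w I (\<lambda>_. 1))"
  using assms
proof (induction I rule: finite_induct)
  case empty
  then show ?case by (auto simp: log_concave_def slice_sum_empty)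
next
  case (insert i I)
  have "slice_sum L w (insert i I) (\<lambda>_. 1) = (\<lambda>s. \<Sum>x\<in>{0..L}. w i x * slice_sum L w I (\<lambda>_. 1) (s - x))"
    using insert.hyps by (simp add: slice_sum_insert fun_eq_iff)
  then show ?case
    using insert by (auto intro!: log_concave_convolution)
qed

section \<open>Efron's theorem for finitely many summands\<close>

text \<open>The vectors \<open>b\<close>, \<open>b'\<close> are arbitrary outside \<open>I\<close>,
  so the condition also makes \<open>f\<close> depend on the coordinates in \<open>I\<close>
  only.\<close>

definition mono_in :: "'i set \<Rightarrow> (('i \<Rightarrow> int) \<Rightarrow> real) \<Rightarrow> bool" where
  "mono_in I f \<longleftrightarrow> (\<forall>b b'. (\<forall>i\<in>I. b i \<le> b' i) \<longrightarrow> f b \<le> f b')"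

lemma mono_inD: "mono_in I f \<Longrightarrow> (\<And>i. i \<in> I \<Longrightarrow> b i \<le> b' i) \<Longrightarrow> f b \<le> f b'"
  by (simp add: mono_in_def)

lemma mono_in_cong:
  "mono_in I f \<Longrightarrow> (\<And>i. i \<in> I \<Longrightarrow> b i = b' i) \<Longrightarrow> f b = f b'"
  by (intro antisym mono_inD[of I f]) auto

text \<open>The inequality says that \<open>F / N\<close> increases. Unit steps can be chained
  because the support of a log-concave \<open>N\<close> has no gaps.\<close>

lemma ratio_mono_from_steps:
  fixes F N :: "int \<Rightarrow> real"
  assumes lc: "log_concave N" and F0: "\<And>s. N s = 0 \<Longrightarrow> F s = 0"
    and step: "\<And>s. F s * N (s + 1) \<le> F (s + 1) * N s" and "s \<le> t"
  shows "F s * N t \<le> F t * N s"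
proof (cases "N s = 0")
  case True
  then show ?thesis using F0 by simp
next
  case False
  then have Ns: "N s > 0" using log_concave_nonneg[OF lc, of s] by simp
  show ?thesis
    using \<open>s \<le> t\<close>
  proof (induction t rule: int_ge_induct)
    case base
    then show ?case by simp
  next
    case (step t)
    show ?case
    proof (cases "N (t + 1) = 0")
      case True
      then show ?thesis using F0 by simp
    next
      case False
      then have Nt1: "N (t + 1) > 0" using log_concave_nonneg[OF lc, of "t + 1"] by simp
      \<comment> \<open>Absence of gaps: \<open>N\<close> is positive at \<open>s\<close> and
        \<open>t + 1\<close>, hence at \<open>t\<close>, and \<open>N t\<close> can be cancelled
        below.\<close>
      have "0 < N s * N (t + 1)" using Ns Nt1 by simp
      also have "\<dots> \<le> N (s + 1) * N t" using step.hyps by (rule log_concave_step[OF lc])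
      finally have Nt: "N t > 0" using log_concave_nonneg[OF lc, of t] by (auto simp: less_le)
      have "F s * N (t + 1) * N t = F s * N t * N (t + 1)" by simp
      also have "\<dots> \<le> F t * N s * N (t + 1)" using step.IH Nt1 by simp
      also have "\<dots> = F t * N (t + 1) * N s" by simp
      also have "\<dots> \<le> F (t + 1) * N t * N s" using assms(3)[of t] Ns by simp
      finally have "(F s * N (t + 1)) * N t \<le> (F (t + 1) * N s) * N t" by (simp add: mult_ac)
      then show ?thesis using Nt by simp
    qed
  qed
qed

text \<open>Single out a coordinate \<open>i\<close> and treat the sum of the others as one
  variable, with log-concave weight \<open>?N\<close>. The conditional mean
  \<open>\<phi> x r\<close> of \<open>f\<close> increases in \<open>x\<close> because
  \<open>f\<close> does, and in \<open>r\<close> by the induction hypothesis, so the case of two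
  summands gives the unit step.\<close>

lemma efron:
  assumes "finite I" "\<And>i. i \<in> I \<Longrightarrow> log_concave (w i)"
    "\<And>i x. i \<in> I \<Longrightarrow> x \<notin> {0..L} \<Longrightarrow> w i x = 0"
    "mono_in I f" "s \<le> t"
  shows "slice_sum L w I f s * slice_sum L w I (\<lambda>_. 1) t
       \<le> slice_sum L w I f t * slice_sum L w I (\<lambda>_. 1) s"
  using assms
proof (induction I arbitrary: f s t rule: finite_induct)
  case empty
  then show ?case by (auto simp: slice_sum_empty)
next
  case (insert i I)
  let ?N = "slice_sum L w I (\<lambda>_. 1)"
  let ?F = "\<lambda>x. slice_sum L w I (\<lambda>b. f (b(i := x)))"
  define \<phi> where "\<phi> x r = ?F x r / ?N r" for x r
  have lcI: "\<And>j. j \<in> I \<Longrightarrow> log_concave (w j)" using insert.prems by simp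
  have lcN: "log_concave ?N" using insert by (intro log_concave_slice_sum) auto
  have FN: "?F x r = ?N r * \<phi> x r" for x r
    using slice_sum_eq_0[OF insert.hyps(1) lcI, where L = L and s = r and f = "\<lambda>b. f (b(i := x))"] by (simp add: \<phi>_def)
  have mono1: "mono_in I (\<lambda>b. f (b(i := x)))" for x
    using insert.prems(3) by (auto simp: mono_in_def)
  have \<phi>1: "\<phi> x r \<le> \<phi> (x + 1) r" for x r
    unfolding \<phi>_def
    by (intro divide_right_mono log_concave_nonneg[OF lcN] slice_sum_mono lcI
          mono_inD[OF insert.prems(3)]) auto
  have \<phi>2: "\<phi> x r \<le> \<phi> x (r + 1)" if "?N r > 0" "?N (r + 1) > 0" for x r
  proof -
    have "?F x r * ?N (r + 1) \<le> ?F x (r + 1) * ?N r"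
      using insert.prems by (intro insert.IH mono1) auto
    then show ?thesis using that by (simp add: \<phi>_def field_simps)
  qed
  have step: "slice_sum L w (insert i I) f r * slice_sum L w (insert i I) (\<lambda>_. 1) (r + 1)
       \<le> slice_sum L w (insert i I) f (r + 1) * slice_sum L w (insert i I) (\<lambda>_. 1) r" for r
    unfolding slice_sum_insert[OF insert.hyps] FN mult.assoc[symmetric]
    using insert.prems by (intro efron_two_summands lcN \<phi>1 \<phi>2) auto
  show ?case
    by (rule ratio_mono_from_steps[OF log_concave_slice_sum slice_sum_eq_0 step insert.prems(4)])
       (use insert in auto)
qed

section \<open>Negative association on a slice\<close>

text \<open>If the \<open>I\<close>-block has sum \<open>x\<close>, the \<open>J\<close>-block has
  sum \<open>s - x\<close>. By \<open>efron\<close> the mean of \<open>f\<close> increases and that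
  of \<open>g\<close> decreases in \<open>x\<close>, and the rearrangement inequality combines the
  two.\<close>

lemma slice_sum_negative_association:
  assumes fin: "finite I" "finite J" and disj: "I \<inter> J = {}"
    and lc: "\<And>i. i \<in> I \<union> J \<Longrightarrow> log_concave (w i)"
    and supp: "\<And>i x. i \<in> I \<union> J \<Longrightarrow> x \<notin> {0..L} \<Longrightarrow> w i x = 0"
    and f: "mono_in I f" and g: "mono_in J g"
  shows "slice_sum L w (I \<union> J) (\<lambda>b. f b * g b) s * slice_sum L w (I \<union> J) (\<lambda>_. 1) s
       \<le> slice_sum L w (I \<union> J) f s * slice_sum L w (I \<union> J) g s"
proof -
  let ?F = "slice_sum L w I" and ?G = "slice_sum L w J"
  have un: "slice_sum L w (I \<union> J) (\<lambda>b. f b * g b) s = (\<Sum>x\<in>{0..s}. ?F f x * ?G g (s - x))"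
    if "mono_in I f" "mono_in J g" for f g
    using mono_in_cong[OF that(1)] mono_in_cong[OF that(2)]
    by (intro slice_sum_Un fin disj) blast+
  \<comment> \<open>Constants are monotone, so \<open>un\<close> also covers the single sums of
    \<open>f\<close> and \<open>g\<close> and the normalization.\<close>
  have 1: "mono_in K (\<lambda>_. 1)" for K by (simp add: mono_in_def)
  have "(\<Sum>x\<in>{0..s}. ?F (\<lambda>_. 1) x * ?G (\<lambda>_. 1) (s - x)) * (\<Sum>x\<in>{0..s}. ?F f x * ?G g (s - x))
      \<le> (\<Sum>x\<in>{0..s}. ?F (\<lambda>_. 1) x * ?G g (s - x)) * (\<Sum>x\<in>{0..s}. ?F f x * ?G (\<lambda>_. 1) (s - x))"
  proof (rule sum_mult_sum_rearrange)
    fix x y :: int assume "x < y"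
    show "?F (\<lambda>_. 1) y * ?F f x \<le> ?F (\<lambda>_. 1) x * ?F f y"
      using efron[of I w L f x y] fin lc supp f \<open>x < y\<close> by (simp add: mult.commute)
    show "?G g (s - y) * ?G (\<lambda>_. 1) (s - x) \<le> ?G g (s - x) * ?G (\<lambda>_. 1) (s - y)"
      using efron[of J w L g "s - y" "s - x"] fin lc supp g \<open>x < y\<close> by simp
  qed simp
  then show ?thesis
    using un[OF f g] un[OF f 1] un[OF 1 g] un[OF 1 1] by (simp add: mult.commute)
qed

section \<open>Poisson weights and their truncations\<close>

text \<open>Passing from \<open>b\<close> to \<open>b + 1\<close> multiplies the weight by
  \<open>q / (b + 1)\<close>, a factor that decreases in \<open>b\<close>.\<close>

lemma log_concave_power_fact:
  assumes "0 \<le> (q::real)"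
  shows "log_concave (\<lambda>b. if 0 \<le> b then q ^ nat b / fact (nat b) else 0)"
proof (rule log_concaveI)
  fix i j :: int assume ij: "i \<le> j"
  show "(if 0 \<le> i then q ^ nat i / fact (nat i) else 0) *
      (if 0 \<le> j + 1 then q ^ nat (j + 1) / fact (nat (j + 1)) else 0)
    \<le> (if 0 \<le> i + 1 then q ^ nat (i + 1) / fact (nat (i + 1)) else 0) *
      (if 0 \<le> j then q ^ nat j / fact (nat j) else 0)"
  proof (cases "0 \<le> i")
    case True
    define a b where "a = nat i" and "b = nat j"
    have ab: "i = int a" "j = int b" "a \<le> b" using True ij by (auto simp: a_def b_def)
    have suc: "nat (1 + int k) = Suc k" for k by simp
    have "q ^ a / fact a * (q ^ Suc b / fact (Suc b)) = (q ^ (a + b + 1) / (fact a * fact b)) / (1 + real b)"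
      by (simp add: field_simps power_add)
    also have "\<dots> \<le> (q ^ (a + b + 1) / (fact a * fact b)) / (1 + real a)"
      using assms ab by (intro divide_left_mono) auto
    also have "\<dots> = q ^ Suc a / fact (Suc a) * (q ^ b / fact b)"
      by (simp add: field_simps power_add)
    finally show ?thesis by (simp add: ab suc add.commute del: power_Suc fact_Suc)
  next
    case False
    then show ?thesis using assms by auto
  qed
qed (use assms in auto)

text \<open>If \<open>i\<close> and \<open>j + 1\<close> lie in \<open>D\<close>, so do
  \<open>i + 1\<close> and \<open>j\<close> between them; otherwise the left side is zero.
  Conditioning on a value of one \<open>x\<close> coordinate truncates its count in this
  way.\<close>

lemma log_concave_restrict:
  assumes w: "log_concave w" and D: "\<And>i j k. i \<in> D \<Longrightarrow> k \<in> D \<Longrightarrow> i \<le> j \<Longrightarrow> j \<le> k \<Longrightarrow> j \<in> D"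
  shows "log_concave (\<lambda>b. w b * of_bool (b \<in> D))"
proof (rule log_concaveI)
  show "0 \<le> w i * of_bool (i \<in> D)" for i using log_concave_nonneg[OF w] by simp
  fix i j :: int assume ij: "i \<le> j"
  show "w i * of_bool (i \<in> D) * (w (j + 1) * of_bool (j + 1 \<in> D))
      \<le> w (i + 1) * of_bool (i + 1 \<in> D) * (w j * of_bool (j \<in> D))"
  proof (cases "i \<in> D \<and> j + 1 \<in> D")
    case True
    then have "i + 1 \<in> D" "j \<in> D" using D[of i "j + 1"] ij by auto
    then show ?thesis using True log_concave_step[OF w ij] by simp
  next
    case False
    then show ?thesis using log_concave_nonneg[OF w] by auto
  qed
qed

section \<open>From increasing events to monotone indicators\<close>

text \<open>Replace the coordinates of \<open>y\<close> that do not affect \<open>A\<close> by those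
  of \<open>x\<close>, one at a time; membership in \<open>A\<close> persists. The result lies below
  \<open>x\<close>.\<close>

lemma increasing_event_affects:
  assumes I: "finite I" and A: "increasing_event I S A" and y: "y \<in> A" and x: "x \<in> PiE I S"
    and le: "\<And>i. i \<in> I \<Longrightarrow> affects I S i A \<Longrightarrow> y i \<le> x i"
  shows "x \<in> A"
proof -
  have yP: "y \<in> PiE I S" using A y by (auto simp: increasing_event_def)
  define z where "z N = (\<lambda>i. if i \<in> N then x i else y i)" for N
  define N where "N = {i\<in>I. \<not> affects I S i A}"
  have zP: "z N \<in> PiE I S" if "N \<subseteq> I" for N
    using x yP that by (auto simp: z_def PiE_iff extensional_def)
  have zA: "z N' \<in> A" if "finite N'" "N' \<subseteq> N" for N'
    using that
  proof (induction N' rule: finite_induct)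
    case empty
    then show ?case using y by (simp add: z_def)
  next
    case (insert i N')
    have "\<not> affects I S i A" "insert i N' \<subseteq> I" using insert by (auto simp: N_def)
    moreover have "z N' \<in> A" using insert by simp
    moreover have "\<forall>j\<in>I - {i}. z N' j = z (insert i N') j" by (auto simp: z_def)
    ultimately show ?case using zP[of "insert i N'"] unfolding affects_def by blast
  qed
  have "z N \<in> A" using I by (intro zA) (auto simp: N_def)
  moreover have "\<forall>i\<in>I. z N i \<le> x i" using le by (auto simp: z_def N_def)
  ultimately show ?thesis using A x unfolding increasing_event_def by blast
qed

lemma threshold_negative_association:
  fixes \<theta> :: "'i \<Rightarrow> int \<Rightarrow> 'a::linorder" and S :: "'i \<Rightarrow> 'a set"
    and w :: "'i \<Rightarrow> int \<Rightarrow> real"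
  defines "X \<equiv> \<lambda>I b. \<lambda>i\<in>I. \<theta> i (b i)"
  assumes I: "finite I"
    and \<theta>: "\<And>i. i \<in> I \<Longrightarrow> mono (\<theta> i)" "\<And>i b. i \<in> I \<Longrightarrow> \<theta> i b \<in> S i"
    and w: "\<And>i. i \<in> I \<Longrightarrow> log_concave (w i)" "\<And>i x. i \<in> I \<Longrightarrow> x \<notin> {0..L} \<Longrightarrow> w i x = 0"
    and A: "increasing_event I S A" and B: "increasing_event I S B" and AB: "perp_events I S A B"
  shows "slice_sum L w I (\<lambda>b. of_bool (X I b \<in> A \<inter> B)) s * slice_sum L w I (\<lambda>_. 1) s
    \<le> slice_sum L w I (\<lambda>b. of_bool (X I b \<in> A)) s * slice_sum L w I (\<lambda>b. of_bool (X I b \<in> B)) s"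
proof -
  \<comment> \<open>By \<open>AB\<close>, the coordinates affecting \<open>B\<close> all lie in
    \<open>I - K\<close>, so the indicators of the two events are monotone in complementary
    blocks.\<close>
  define K where "K = {i\<in>I. affects I S i A}"
  have mono: "mono_in K (\<lambda>b. of_bool (X I b \<in> A))"
    if A: "increasing_event I S A" and K: "\<And>i. i \<in> I \<Longrightarrow> affects I S i A \<Longrightarrow> i \<in> K" for A K
    unfolding mono_in_def
  proof (intro allI impI)
    fix b b' :: "'i \<Rightarrow> int" assume le: "\<forall>i\<in>K. b i \<le> b' i"
    have "X I b' \<in> A" if "X I b \<in> A"
      by (rule increasing_event_affects[OF I A that]) (use le K \<theta> in \<open>auto simp: X_def intro: monoD\<close>)
    then show "(of_bool (X I b \<in> A) :: real) \<le> of_bool (X I b' \<in> A)" by simp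
  qed
  have "slice_sum L w (K \<union> (I - K)) (\<lambda>b. of_bool (X I b \<in> A) * of_bool (X I b \<in> B)) s
      * slice_sum L w (K \<union> (I - K)) (\<lambda>_. 1) s
    \<le> slice_sum L w (K \<union> (I - K)) (\<lambda>b. of_bool (X I b \<in> A)) s
      * slice_sum L w (K \<union> (I - K)) (\<lambda>b. of_bool (X I b \<in> B)) s"
    using I w AB by (intro slice_sum_negative_association mono A B)
      (auto simp: K_def perp_events_def)
  moreover have "K \<union> (I - K) = I" by (auto simp: K_def)
  ultimately show ?thesis by (simp add: of_bool_conj)
qed

section \<open>The multinomial law of the counts\<close>

lemma PiE_nonneg_sum_eq:
  fixes c :: int
  assumes "finite J"
  shows "{b\<in>PiE J (\<lambda>_. {0..}). sum b J = c} = {b\<in>PiE J (\<lambda>_. {0..c}). sum b J = c}"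
proof (intro equalityI subsetI)
  fix b assume "b \<in> {b\<in>PiE J (\<lambda>_. {0..}). sum b J = c}"
  then show "b \<in> {b\<in>PiE J (\<lambda>_. {0..c}). sum b J = c}"
    using member_le_sum[of _ J b] assms by (auto simp: PiE_iff)
qed auto

text \<open>Induction on the number of draws, for all \<open>h\<close> at once: a further draw with
  value \<open>j\<close> raises count \<open>j\<close> by one and replaces \<open>h\<close> by its
  shift. Since \<open>(b j + 1) * W (b(j := b j + 1)) = p j * W b\<close>, the shift produces a
  factor \<open>b j\<close>, and these add up over \<open>j\<close> to the new number of draws,
  extending the factorial.\<close>

lemma sum_over_functions_by_counts:
  fixes p :: "'j \<Rightarrow> real" and h :: "('j \<Rightarrow> int) \<Rightarrow> real"
  assumes "finite T" and J: "finite J"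
  shows "(\<Sum>\<tau>\<in>PiE T (\<lambda>_. J). (\<Prod>i\<in>T. p (\<tau> i)) * h (\<lambda>j\<in>J. int (card {i\<in>T. \<tau> i = j})))
    = fact (card T) * (\<Sum>b\<in>{b\<in>PiE J (\<lambda>_. {0..}). sum b J = int (card T)}.
        (\<Prod>j\<in>J. p j ^ nat (b j) / fact (nat (b j))) * h b)"
  using assms(1)
proof (induction T arbitrary: h rule: finite_induct)
  case empty
  have "{b\<in>PiE J (\<lambda>_. {0..}). sum b J = (0::int)} = {\<lambda>j\<in>J. 0}"
    using J by (auto simp: sum_nonneg_eq_0_iff PiE_iff extensional_def fun_eq_iff)
  then show ?case by simp
next
  case (insert t T)
  define C where "C k = {b\<in>PiE J (\<lambda>_. {0..}). sum b J = int k}" for k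
  define W where "W b = (\<Prod>j\<in>J. p j ^ nat (b j) / fact (nat (b j)))" for b :: "'j \<Rightarrow> int"
  let ?cnt = "\<lambda>T \<tau>. \<lambda>j\<in>J. int (card {i\<in>T. \<tau> i = j})"
  have inj: "inj_on (\<lambda>(y, g). g(t := y)) (J \<times> PiE T (\<lambda>_. J))"
    using inj_combinator[of t T "\<lambda>_. J"] insert.hyps by simp
  have prodp: "(\<Prod>i\<in>insert t T. p ((\<tau>(t := j)) i)) = p j * (\<Prod>i\<in>T. p (\<tau> i))" for \<tau> j
    using insert.hyps by (auto intro!: prod.cong)
  have cnt: "?cnt (insert t T) (\<tau>(t := j)) = (?cnt T \<tau>)(j := ?cnt T \<tau> j + 1)" if "j \<in> J" for \<tau> j
  proof
    fix l
    have "{i \<in> insert t T. (\<tau>(t := j)) i = l} =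
        (if l = j then insert t {i\<in>T. \<tau> i = l} else {i\<in>T. \<tau> i = l})"
      using insert.hyps by auto
    then have "int (card {i \<in> insert t T. (\<tau>(t := j)) i = l})
        = int (card {i\<in>T. \<tau> i = l}) + (if l = j then 1 else 0)"
      using insert.hyps by (simp only:) simp
    then show "?cnt (insert t T) (\<tau>(t := j)) l = ((?cnt T \<tau>)(j := ?cnt T \<tau> j + 1)) l"
      using that by (cases "l = j") simp_all
  qed
  have finC: "finite (C k)" for k
    unfolding C_def PiE_nonneg_sum_eq[OF J] using J
    by (intro finite_subset[OF Collect_restrict] finite_PiE) auto
  have shift: "(\<Sum>b\<in>C k. p j * (W b * h (b(j := b j + 1)))) = (\<Sum>b\<in>C (Suc k). b j * (W b * h b))"
    if j: "j \<in> J" for j k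
  proof -
    have upd: "sum (b(j := x)) J = x + (sum b J - b j)" for b :: "'j \<Rightarrow> int" and x
      using J j by (simp add: sum.remove[where x=j])
    have wt: "real_of_int (b j + 1) * W (b(j := b j + 1)) = p j * W b" if "b j \<ge> 0" for b
    proof -
      from that obtain r where r: "b j = int r" by (rule nonneg_int_cases)
      have split: "W c = p j ^ nat (c j) / fact (nat (c j)) *
          (\<Prod>i\<in>J - {j}. p i ^ nat (c i) / fact (nat (c i)))" for c
        unfolding W_def using J j by (rule prod.remove)
      have rest: "(\<Prod>i\<in>J - {j}. p i ^ nat ((b(j := b j + 1)) i) / fact (nat ((b(j := b j + 1)) i)))
          = (\<Prod>i\<in>J - {j}. p i ^ nat (b i) / fact (nat (b i)))"
        by (intro prod.cong) auto
      have "nat (b j + 1) = Suc r" "nat (b j) = r" "real_of_int (b j + 1) = real (Suc r)"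
        using r by auto
      then have "real_of_int (b j + 1) * (p j ^ nat (b j + 1) / fact (nat (b j + 1)))
          = p j * (p j ^ nat (b j) / fact (nat (b j)))"
        by (simp del: of_nat_Suc)
      then show ?thesis
        unfolding split rest fun_upd_same by (simp only: mult.assoc[symmetric])
    qed
    \<comment> \<open>Adding a unit at \<open>j\<close> is a bijection onto the vectors with
      \<open>b j \<noteq> 0\<close>; the others carry the factor \<open>b j = 0\<close>.\<close>
    have "(\<Sum>b\<in>C k. p j * (W b * h (b(j := b j + 1)))) = (\<Sum>b\<in>{b\<in>C (Suc k). b j \<noteq> 0}. b j * (W b * h b))"
    proof (rule sum.reindex_bij_witness[where i="\<lambda>b. b(j := b j - 1)" and j="\<lambda>b. b(j := b j + 1)"])
      fix b assume b: "b \<in> C k"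
      then have nn: "b j \<ge> 0" using j by (auto simp: C_def)
      show "b(j := b j + 1) \<in> {b\<in>C (Suc k). b j \<noteq> 0}"
      proof -
        have "sum (b(j := b j + 1)) J = int (Suc k)"
          using b by (simp add: C_def upd del: fun_upd_apply)
        moreover have "b(j := b j + 1) \<in> PiE J (\<lambda>_. {0..})" "(b(j := b j + 1)) j \<noteq> 0"
          using b nn j by (auto simp: C_def PiE_iff extensional_def)
        ultimately show ?thesis unfolding C_def by blast
      qed
      show "real_of_int ((b(j := b j + 1)) j) * (W (b(j := b j + 1)) * h (b(j := b j + 1)))
          = p j * (W b * h (b(j := b j + 1)))"
        unfolding fun_upd_same mult.assoc[symmetric] wt[of b, OF nn] ..
    next
      fix b assume b: "b \<in> {b\<in>C (Suc k). b j \<noteq> 0}"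
      then have "b j \<ge> 0" "b j \<noteq> 0" using j by (auto simp: C_def)
      then have "b(j := b j - 1) \<in> PiE J (\<lambda>_. {0..})"
        using b j by (auto simp: C_def PiE_iff extensional_def)
      moreover have "sum (b(j := b j - 1)) J = int k"
        using b by (simp add: C_def upd del: fun_upd_apply)
      ultimately show "b(j := b j - 1) \<in> C k" unfolding C_def by blast
    qed auto
    also have "\<dots> = (\<Sum>b\<in>C (Suc k). b j * (W b * h b))"
      using finC by (intro sum.mono_neutral_left) auto
    finally show ?thesis .
  qed
  have "(\<Sum>\<tau>\<in>PiE (insert t T) (\<lambda>_. J). (\<Prod>i\<in>insert t T. p (\<tau> i)) * h (?cnt (insert t T) \<tau>))
    = (\<Sum>(j, \<tau>)\<in>J \<times> PiE T (\<lambda>_. J).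
        p j * ((\<Prod>i\<in>T. p (\<tau> i)) * h ((?cnt T \<tau>)(j := ?cnt T \<tau> j + 1))))"
    unfolding PiE_insert_eq sum.reindex[OF inj]
  proof (intro sum.cong refl, clarify)
    fix j \<tau> assume "j \<in> J"
    show "((\<lambda>\<tau>. (\<Prod>i\<in>insert t T. p (\<tau> i)) * h (?cnt (insert t T) \<tau>)) \<circ> (\<lambda>(y, g). g(t := y))) (j, \<tau>)
       = p j * ((\<Prod>i\<in>T. p (\<tau> i)) * h ((?cnt T \<tau>)(j := ?cnt T \<tau> j + 1)))"
      unfolding comp_def prod.case prodp cnt[OF \<open>j \<in> J\<close>] by (simp add: mult.assoc)
  qed
  also have "\<dots> = (\<Sum>j\<in>J. p j * (\<Sum>\<tau>\<in>PiE T (\<lambda>_. J).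
        (\<Prod>i\<in>T. p (\<tau> i)) * h ((?cnt T \<tau>)(j := ?cnt T \<tau> j + 1))))"
    unfolding sum_distrib_left sum.cartesian_product ..
  also have "\<dots> = (\<Sum>j\<in>J. p j * (fact (card T) * (\<Sum>b\<in>C (card T). W b * h (b(j := b j + 1)))))"
    unfolding C_def W_def
    by (intro sum.cong refl arg_cong2[where f="(*)"] insert.IH[where h = "\<lambda>b. h (b(j := b j + 1))" for j])
  also have "\<dots> = fact (card T) * (\<Sum>j\<in>J. \<Sum>b\<in>C (card T). p j * (W b * h (b(j := b j + 1))))"
    by (simp add: sum_distrib_left mult_ac)
  also have "\<dots> = fact (card T) * (\<Sum>j\<in>J. \<Sum>b\<in>C (Suc (card T)). b j * (W b * h b))"
    using shift by simp
  also have "(\<Sum>j\<in>J. \<Sum>b\<in>C (Suc (card T)). b j * (W b * h b))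
      = (\<Sum>b\<in>C (Suc (card T)). real_of_int (sum b J) * (W b * h b))"
    by (subst sum.swap) (simp add: sum_distrib_right)
  also have "\<dots> = (\<Sum>b\<in>C (Suc (card T)). real (Suc (card T)) * (W b * h b))"
    by (intro sum.cong) (auto simp: C_def)
  also have "fact (card T) * \<dots> = fact (card (insert t T)) * (\<Sum>b\<in>C (card (insert t T)). W b * h b)"
    using insert.hyps by (simp add: sum_distrib_left mult_ac)
  finally show ?case by (simp add: C_def W_def)
qed

lemma sum_over_functions_by_slices:
  fixes p :: "'j \<Rightarrow> real" and h :: "('j \<Rightarrow> int) \<Rightarrow> real"
  assumes "finite T" and J: "finite J"
  shows "(\<Sum>\<tau>\<in>PiE T (\<lambda>_. J). (\<Prod>i\<in>T. p (\<tau> i)) * h (\<lambda>j\<in>J. int (card {i\<in>T. \<tau> i = j})))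
    = fact (card T) * slice_sum (int (card T)) (\<lambda>j b. p j ^ nat b / fact (nat b)) J h (int (card T))"
proof -
  let ?m = "int (card T)"
  have "finite (PiE J (\<lambda>_. {0..?m}))" using J by (intro finite_PiE) auto
  then show ?thesis
    using sum_over_functions_by_counts[OF assms, of p h]
    by (simp add: PiE_nonneg_sum_eq[OF J] slice_sum_def sum.inter_filter[symmetric])
qed

text \<open>The event is a finite disjoint union of the cylinders \<open>Z \<tau>\<close>, each
  measurable and of product probability by independence.\<close>

lemma (in prob_space)
  assumes indep: "indep_vars (\<lambda>_. count_space J) \<sigma> T" and T: "finite T" "T \<noteq> {}" and J: "finite J"
    and p: "\<And>i j. i \<in> T \<Longrightarrow> j \<in> J \<Longrightarrow> prob (\<sigma> i -` {j} \<inter> space M) = p j"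
  shows events_iid_function: "{\<omega>\<in>space M. P (\<lambda>i\<in>T. \<sigma> i \<omega>)} \<in> events"
    and prob_iid_function: "prob {\<omega>\<in>space M. P (\<lambda>i\<in>T. \<sigma> i \<omega>)}
      = (\<Sum>\<tau>\<in>PiE T (\<lambda>_. J). (\<Prod>i\<in>T. p (\<tau> i)) * of_bool (P \<tau>))"
proof -
  define Z where "Z \<tau> = (\<Inter>i\<in>T. \<sigma> i -` {\<tau> i} \<inter> space M)" for \<tau>
  let ?Q = "{\<tau>\<in>PiE T (\<lambda>_. J). P \<tau>}"
  have rv: "\<sigma> i \<in> measurable M (count_space J)" if "i \<in> T" for i
    using indep that by (auto simp: indep_vars_def)
  have finQ: "finite (PiE T (\<lambda>_. J))" using T J by (intro finite_PiE) auto
  have ZE: "Z \<tau> \<in> events" if "\<tau> \<in> PiE T (\<lambda>_. J)" for \<tau>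
    unfolding Z_def using T that
    by (intro sets.finite_INT measurable_sets[OF rv]) (auto simp: PiE_iff)
  have pZ: "prob (Z \<tau>) = (\<Prod>i\<in>T. p (\<tau> i))" if "\<tau> \<in> PiE T (\<lambda>_. J)" for \<tau>
  proof -
    have "prob (Z \<tau>) = (\<Prod>i\<in>T. prob (\<sigma> i -` {\<tau> i} \<inter> space M))"
      unfolding Z_def using that T by (intro indep_varsD_finite[OF indep]) (auto simp: PiE_iff)
    then show ?thesis using p that by (simp add: PiE_iff)
  qed
  have Zs: "\<tau> = (\<lambda>i\<in>T. \<sigma> i \<omega>)" if "\<tau> \<in> PiE T (\<lambda>_. J)" "\<omega> \<in> Z \<tau>" for \<tau> \<omega>
    using that T by (auto simp: Z_def PiE_iff extensional_def fun_eq_iff)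
  have eq: "{\<omega>\<in>space M. P (\<lambda>i\<in>T. \<sigma> i \<omega>)} = (\<Union>\<tau>\<in>?Q. Z \<tau>)"
  proof (intro equalityI subsetI)
    fix \<omega> assume \<omega>: "\<omega> \<in> {\<omega>\<in>space M. P (\<lambda>i\<in>T. \<sigma> i \<omega>)}"
    then have "(\<lambda>i\<in>T. \<sigma> i \<omega>) \<in> ?Q" using measurable_space[OF rv] by auto
    moreover have "\<omega> \<in> Z (\<lambda>i\<in>T. \<sigma> i \<omega>)" using \<omega> T by (auto simp: Z_def)
    ultimately show "\<omega> \<in> (\<Union>\<tau>\<in>?Q. Z \<tau>)" by blast
  next
    fix \<omega> assume "\<omega> \<in> (\<Union>\<tau>\<in>?Q. Z \<tau>)"
    then obtain \<tau> where \<tau>: "\<tau> \<in> ?Q" "\<omega> \<in> Z \<tau>" by blast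
    moreover have "\<omega> \<in> space M" using \<tau> T by (auto simp: Z_def)
    ultimately show "\<omega> \<in> {\<omega>\<in>space M. P (\<lambda>i\<in>T. \<sigma> i \<omega>)}" using Zs[of \<tau> \<omega>] by auto
  qed
  show "{\<omega>\<in>space M. P (\<lambda>i\<in>T. \<sigma> i \<omega>)} \<in> events"
    unfolding eq using finQ ZE by (intro sets.finite_UN) auto
  have "prob (\<Union>\<tau>\<in>?Q. Z \<tau>) = (\<Sum>\<tau>\<in>?Q. prob (Z \<tau>))"
  proof (rule finite_measure_finite_Union)
    show "disjoint_family_on Z ?Q"
      unfolding disjoint_family_on_def using Zs by blast
  qed (use finQ ZE in auto)
  also have "\<dots> = (\<Sum>\<tau>\<in>PiE T (\<lambda>_. J). (\<Prod>i\<in>T. p (\<tau> i)) * of_bool (P \<tau>))"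
    using finQ by (simp add: pZ sum.inter_filter of_bool_def if_distrib cong: if_cong)
  finally show "prob {\<omega>\<in>space M. P (\<lambda>i\<in>T. \<sigma> i \<omega>)}
      = (\<Sum>\<tau>\<in>PiE T (\<lambda>_. J). (\<Prod>i\<in>T. p (\<tau> i)) * of_bool (P \<tau>))" unfolding eq .
qed

section \<open>Thresholds and conditioning\<close>

text \<open>Counting only the inner thresholds makes the value monotone in \<open>b\<close> and
  smaller than a positive \<open>k\<close> for every integer \<open>b\<close>, including those that
  no count attains.\<close>

definition level :: "(nat \<Rightarrow> int) \<Rightarrow> nat \<Rightarrow> int \<Rightarrow> nat" where
  "level a k b = card {t\<in>{1..<k}. a t \<le> b}"

lemma mono_level: "mono (level a k)"
  unfolding level_def by (intro monoI card_mono) auto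

lemma level_less: "0 < k \<Longrightarrow> level a k b < k"
proof -
  assume k: "0 < k"
  have "level a k b \<le> card {1..<k}" unfolding level_def by (intro card_mono) auto
  then show ?thesis using k by simp
qed

lemma level_eqI:
  assumes inc: "\<And>t. t < k \<Longrightarrow> a t < a (t + 1)" and t: "t < k" "a t \<le> b" "b < a (t + 1)"
  shows "level a k b = t"
proof -
  have mono: "a r \<le> a s" if "r \<le> s" "s \<le> k" for r s
    using that
  proof (induction s rule: dec_induct)
    case (step s)
    then show ?case using inc[of s] by simp
  qed simp
  have "a r \<le> b \<longleftrightarrow> r \<le> t" if "r < k" for r
    using mono[of r t] mono[of "t + 1" r] t that by (cases "r \<le> t") auto
  then have "{r\<in>{1..<k}. a r \<le> b} = {1..t}" using t(1) by auto
  then show ?thesis by (simp add: level_def)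
qed

text \<open>Multiplying by the square of the probability of the conditioning event clears the
  normalizations.\<close>

lemma conditionally_negatively_associatedI:
  fixes I :: "'i set" and S :: "'i \<Rightarrow> 'a::linorder set" and \<mu> :: "('i \<Rightarrow> 'a) measure"
  assumes \<mu>: "prob_measure_on (PiE I S) \<mu>"
    and na: "\<And>J v A B. J \<subseteq> I \<Longrightarrow> increasing_event I S A \<Longrightarrow> increasing_event I S B \<Longrightarrow>
      perp_events I S A B \<Longrightarrow>
      measure \<mu> ({x\<in>PiE I S. \<forall>j\<in>J. x j = v j} \<inter> (A \<inter> B)) * measure \<mu> {x\<in>PiE I S. \<forall>j\<in>J. x j = v j}
      \<le> measure \<mu> ({x\<in>PiE I S. \<forall>j\<in>J. x j = v j} \<inter> A) *
         measure \<mu> ({x\<in>PiE I S. \<forall>j\<in>J. x j = v j} \<inter> B)"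
  shows "conditionally_negatively_associated I S \<mu>"
  unfolding conditionally_negatively_associated_def
proof (intro conjI allI impI \<mu>)
  fix J :: "'i set" and v :: "'i \<Rightarrow> 'a"
  define E where "E = {x\<in>PiE I S. \<forall>j\<in>J. x j = v j}"
  assume J: "J \<subseteq> I" and "0 < measure \<mu> {x\<in>PiE I S. \<forall>j\<in>J. x j = v j}"
  then have E: "0 < measure \<mu> E" by (simp add: E_def)
  interpret prob_space \<mu> using \<mu> by (simp add: prob_measure_on_def)
  have sets: "sets \<mu> = Pow (PiE I S)" "space \<mu> = PiE I S" using \<mu> by (auto simp: prob_measure_on_def)
  have nz: "emeasure \<mu> E \<noteq> 0" "emeasure \<mu> E \<noteq> \<infinity>"
    using E by (auto simp: emeasure_eq_measure)
  have cond: "measure (uniform_measure \<mu> E) A = measure \<mu> (E \<inter> A) / measure \<mu> E" if "A \<subseteq> PiE I S" for A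
    using that nz sets by (intro measure_uniform_measure) auto
  show "negatively_associated I S (uniform_measure \<mu> {x\<in>PiE I S. \<forall>j\<in>J. x j = v j})"
    unfolding negatively_associated_def E_def[symmetric]
  proof (intro conjI allI impI)
    show "prob_measure_on (PiE I S) (uniform_measure \<mu> E)"
      using prob_space_uniform_measure[OF nz] sets by (simp add: prob_measure_on_def)
    fix A B assume A: "increasing_event I S A" and B: "increasing_event I S B" and "perp_events I S A B"
    then have "measure \<mu> (E \<inter> (A \<inter> B)) * measure \<mu> E \<le> measure \<mu> (E \<inter> A) * measure \<mu> (E \<inter> B)"
      using na[OF J A B] by (simp add: E_def)
    moreover have "A \<subseteq> PiE I S" "B \<subseteq> PiE I S" "A \<inter> B \<subseteq> PiE I S"
      using A B by (auto simp: increasing_event_def)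
    ultimately show "measure (uniform_measure \<mu> E) (A \<inter> B)
        \<le> measure (uniform_measure \<mu> E) A * measure (uniform_measure \<mu> E) B"
      using E by (simp add: cond field_simps)
  qed
qed

text \<open>A factor of product form can be absorbed into the weights; the indicator of a
  conditioning event will be such a factor.\<close>

lemma slice_sum_reweight:
  assumes fin: "finite I"
    and eq: "\<And>b. b \<in> PiE I (\<lambda>_. {0..L}) \<Longrightarrow> f b = (\<Prod>i\<in>I. r i (b i)) * g b"
    and w': "\<And>i b. i \<in> I \<Longrightarrow> 0 \<le> b \<Longrightarrow> b \<le> L \<Longrightarrow> w' i b = w i b * r i b"
  shows "slice_sum L w I f s = slice_sum L w' I g s"
  unfolding slice_sum_def
proof (intro sum.cong refl)
  fix b assume b: "b \<in> PiE I (\<lambda>_. {0..L})"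
  then have "(\<Prod>i\<in>I. w' i (b i)) = (\<Prod>i\<in>I. w i (b i)) * (\<Prod>i\<in>I. r i (b i))"
    unfolding prod.distrib[symmetric] by (intro prod.cong) (auto simp: w' PiE_iff)
  then show "(if sum b I = s then (\<Prod>i\<in>I. w i (b i)) * f b else 0)
      = (if sum b I = s then (\<Prod>i\<in>I. w' i (b i)) * g b else 0)"
    using eq[OF b] by simp
qed

theorem theorem2:
  fixes m n :: nat
    and M :: "'w measure"
    and D :: "nat measure"
    and \<sigma> :: "nat \<Rightarrow> 'w \<Rightarrow> nat"
    and k :: "nat \<Rightarrow> nat"
    and a :: "nat \<Rightarrow> nat \<Rightarrow> int"
    and B :: "nat \<Rightarrow> 'w \<Rightarrow> nat"
    and x :: "nat \<Rightarrow> 'w \<Rightarrow> nat"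
  assumes "m \<ge> 1" and "n \<ge> 1"
    and "prob_space M"
    and "prob_space.indep_vars M (\<lambda>_. count_space {1..n}) \<sigma> {1..m}"
    and "\<And>i. i \<in> {1..m} \<Longrightarrow> distr M (count_space {1..n}) (\<sigma> i) = D"
    and "\<And>j. j \<in> {1..n} \<Longrightarrow> a j 0 = 0"
    and "\<And>j t. j \<in> {1..n} \<Longrightarrow> t < k j \<Longrightarrow> a j t < a j (t + 1)"
    and "\<And>j. j \<in> {1..n} \<Longrightarrow> a j (k j) = int m + 1"
    and "\<And>j \<omega>. j \<in> {1..n} \<Longrightarrow> \<omega> \<in> space M \<Longrightarrow> B j \<omega> = card {i\<in>{1..m}. \<sigma> i \<omega> = j}"
    and "\<And>j \<omega>. j \<in> {1..n} \<Longrightarrow> \<omega> \<in> space M \<Longrightarrow> x j \<omega> \<in> {0..<k j}"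
    and "\<And>j \<omega> t. j \<in> {1..n} \<Longrightarrow> \<omega> \<in> space M \<Longrightarrow> t \<in> {0..<k j} \<Longrightarrow>
           x j \<omega> = t \<longleftrightarrow> a j t \<le> int (B j \<omega>) \<and> int (B j \<omega>) < a j (t + 1)"
  shows "conditionally_negatively_associated {1..n} (\<lambda>j. {0..<k j})
           (distr M (count_space (PiE {1..n} (\<lambda>j. {0..<k j}))) (\<lambda>\<omega>. \<lambda>j\<in>{1..n}. x j \<omega>))"
proof -
  interpret prob_space M by fact
  let ?T = "{1..m}" and ?I = "{1..n}" and ?S = "\<lambda>j. {0..<k j}"
  let ?\<Omega> = "PiE ?I ?S"
  define \<xi> where "\<xi> \<omega> = (\<lambda>j\<in>?I. x j \<omega>)" for \<omega>
  define \<mu> where "\<mu> = distr M (count_space ?\<Omega>) \<xi>"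
  define p where "p j = measure D {j}" for j
  define \<theta> where "\<theta> j = level (a j) (k j)" for j
  define X where "X b = (\<lambda>j\<in>?I. \<theta> j (b j))" for b
  define cnt where "cnt \<tau> = (\<lambda>j\<in>?I. int (card {i\<in>?T. \<tau> i = j}))" for \<tau> :: "nat \<Rightarrow> nat"
  define wt where "wt = (\<lambda>j b. p j ^ nat b / fact (nat b))"
  have k: "0 < k j" if "j \<in> ?I" for j
    using assms(6)[OF that] assms(8)[OF that] by (cases "k j") auto
  have \<theta>: "mono (\<theta> j)" "\<theta> j b \<in> {0..<k j}" if "j \<in> ?I" for j b
    using mono_level level_less[OF k[OF that]] by (auto simp: \<theta>_def)
  have X\<Omega>: "X b \<in> ?\<Omega>" for b using \<theta>(2) by (auto simp: X_def)
  have \<xi>X: "\<xi> \<omega> = X (cnt (\<lambda>i\<in>?T. \<sigma> i \<omega>))" if \<omega>: "\<omega> \<in> space M" for \<omega>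
  proof -
    have "\<theta> j (cnt (\<lambda>i\<in>?T. \<sigma> i \<omega>) j) = x j \<omega>" if j: "j \<in> ?I" for j
    proof -
      have "{i\<in>?T. (\<lambda>i\<in>?T. \<sigma> i \<omega>) i = j} = {i\<in>?T. \<sigma> i \<omega> = j}" by auto
      then have "cnt (\<lambda>i\<in>?T. \<sigma> i \<omega>) j = int (B j \<omega>)"
        using j assms(9)[OF j \<omega>] by (simp add: cnt_def)
      moreover have "level (a j) (k j) (int (B j \<omega>)) = x j \<omega>"
        using assms(7)[OF j] assms(10)[OF j \<omega>] assms(11)[OF j \<omega> assms(10)[OF j \<omega>]]
        by (intro level_eqI) auto
      ultimately show ?thesis by (simp add: \<theta>_def)
    qed
    then show ?thesis by (auto simp: X_def \<xi>_def)
  qed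
  have \<sigma>p: "prob (\<sigma> i -` {j} \<inter> space M) = p j" if "i \<in> ?T" "j \<in> ?I" for i j
  proof -
    have "\<sigma> i \<in> measurable M (count_space ?I)" using assms(4) that by (auto simp: indep_vars_def)
    then show ?thesis using that by (simp add: p_def assms(5)[OF that(1), symmetric] measure_distr)
  qed
  have pre: "{\<omega>\<in>space M. \<xi> \<omega> \<in> E} = {\<omega>\<in>space M. X (cnt (\<lambda>i\<in>?T. \<sigma> i \<omega>)) \<in> E}" for E
    using \<xi>X by auto
  have T: "finite ?T" "?T \<noteq> {}" "finite ?I" using assms(1) by auto
  \<comment> \<open>Measurability of \<open>\<xi>\<close> is derived: on \<open>space M\<close> it
    is a function of the finitely many draws.\<close>
  have ev: "\<xi> -` E \<inter> space M \<in> events" for E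
  proof -
    have "{\<omega>\<in>space M. \<xi> \<omega> \<in> E} \<in> events"
      unfolding pre by (rule events_iid_function[OF assms(4) T \<sigma>p])
    then show ?thesis by (simp add: vimage_def Int_def conj_commute)
  qed
  have \<xi>m: "\<xi> \<in> measurable M (count_space ?\<Omega>)"
    using ev X\<Omega> \<xi>X by (intro measurableI) auto
  have \<mu>E: "measure \<mu> E = fact m * slice_sum (int m) wt ?I (\<lambda>b. of_bool (X b \<in> E)) (int m)"
    if "E \<subseteq> ?\<Omega>" for E
  proof -
    have "measure \<mu> E = prob (\<xi> -` E \<inter> space M)"
      unfolding \<mu>_def using that by (intro measure_distr[OF \<xi>m]) simp
    also have "\<xi> -` E \<inter> space M = {\<omega>\<in>space M. X (cnt (\<lambda>i\<in>?T. \<sigma> i \<omega>)) \<in> E}"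
      unfolding pre[symmetric] by blast
    also have "prob \<dots> = (\<Sum>\<tau>\<in>PiE ?T (\<lambda>_. ?I). (\<Prod>i\<in>?T. p (\<tau> i)) * of_bool (X (cnt \<tau>) \<in> E))"
      by (rule prob_iid_function[OF assms(4) T \<sigma>p])
    also have "\<dots> = fact (card ?T) * slice_sum (int (card ?T)) wt ?I (\<lambda>b. of_bool (X b \<in> E)) (int (card ?T))"
      unfolding cnt_def wt_def
      by (rule sum_over_functions_by_slices[OF T(1,3), where h = "\<lambda>b. of_bool (X b \<in> E)"])
    also have "card ?T = m" by simp
    finally show ?thesis .
  qed
  have "conditionally_negatively_associated ?I ?S \<mu>"
  proof (rule conditionally_negatively_associatedI)
    show "prob_measure_on ?\<Omega> \<mu>"
      using prob_space_distr[OF \<xi>m] by (simp add: prob_measure_on_def \<mu>_def)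
  next
    fix J v A B
    assume J: "J \<subseteq> ?I" and A: "increasing_event ?I ?S A" and B: "increasing_event ?I ?S B"
      and AB: "perp_events ?I ?S A B"
    define E where "E = {x\<in>?\<Omega>. \<forall>j\<in>J. x j = v j}"
    \<comment> \<open>The counts that the conditioning allows for coordinate \<open>j\<close>; the
      bounds put the support of \<open>w j\<close> inside \<open>{0..int m}\<close>.\<close>
    define G where "G j = {b. 0 \<le> b \<and> b \<le> int m \<and> (j \<in> J \<longrightarrow> \<theta> j b = v j)}" for j
    define w where
      "w = (\<lambda>j b. (if 0 \<le> b then p j ^ nat b / fact (nat b) else 0) * of_bool (b \<in> G j))"
    have lcw: "log_concave (w j)" if "j \<in> ?I" for j
    proof -
      \<comment> \<open>A monotone \<open>\<theta> j\<close> equal to \<open>v j\<close> at two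
        points is equal to it in between.\<close>
      have conv: "b' \<in> G j" if "b \<in> G j" "b'' \<in> G j" "b \<le> b'" "b' \<le> b''" for b b' b''
        using that monoD[OF \<theta>(1)[OF \<open>j \<in> ?I\<close>], of b b'] monoD[OF \<theta>(1)[OF \<open>j \<in> ?I\<close>], of b' b'']
        by (auto simp: G_def)
      have "log_concave (\<lambda>b. (if 0 \<le> b then p j ^ nat b / fact (nat b) else 0) * of_bool (b \<in> G j))"
      proof (rule log_concave_restrict)
        show "log_concave (\<lambda>b. if 0 \<le> b then p j ^ nat b / fact (nat b) else 0)"
          by (rule log_concave_power_fact) (simp add: p_def)
      qed (rule conv)
      then show ?thesis by (simp add: w_def)
    qed
    have XE: "X b \<in> E \<longleftrightarrow> (\<forall>j\<in>J. \<theta> j (b j) = v j)" for b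
    proof -
      have "X b \<in> E \<longleftrightarrow> (\<forall>j\<in>J. X b j = v j)" using X\<Omega>[of b] unfolding E_def by blast
      moreover have "X b j = \<theta> j (b j)" if "j \<in> J" for j
        using subsetD[OF J that] unfolding X_def by (rule restrict_apply')
      ultimately show ?thesis by simp
    qed
    \<comment> \<open>The indicator of \<open>E\<close> is a product of one-coordinate indicators,
      so conditioning only changes the weights from \<open>wt\<close> to \<open>w\<close>.\<close>
    have cond: "slice_sum (int m) wt ?I (\<lambda>b. of_bool (X b \<in> E \<inter> F)) s
        = slice_sum (int m) w ?I (\<lambda>b. of_bool (X b \<in> F)) s" for F s
    proof (rule slice_sum_reweight[where r = "\<lambda>j b. of_bool (b \<in> G j)"])
      fix b assume "b \<in> PiE ?I (\<lambda>_. {0..int m})"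
      then have "X b \<in> E \<longleftrightarrow> (\<forall>j\<in>?I. b j \<in> G j)" 
        unfolding XE G_def using J by (fastforce simp: PiE_iff)
      moreover have "(\<Prod>j\<in>?I. of_bool (b j \<in> G j)) = (of_bool (\<forall>j\<in>?I. b j \<in> G j) :: real)"
        by (cases "\<forall>j\<in>?I. b j \<in> G j") auto
      ultimately show "(of_bool (X b \<in> E \<inter> F) :: real) = (\<Prod>j\<in>?I. of_bool (b j \<in> G j)) * of_bool (X b \<in> F)"
        by simp
    qed (auto simp: w_def wt_def)
    have \<mu>EF: "measure \<mu> (E \<inter> F) = fact m * slice_sum (int m) w ?I (\<lambda>b. of_bool (X b \<in> F)) (int m)" for F
    proof -
      have "E \<inter> F \<subseteq> ?\<Omega>" unfolding E_def by blast
      then show ?thesis by (simp only: \<mu>E cond)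
    qed
    have \<mu>E': "measure \<mu> E = fact m * slice_sum (int m) w ?I (\<lambda>_. 1) (int m)"
      using \<mu>EF[of UNIV] by simp
    have "slice_sum (int m) w ?I (\<lambda>b. of_bool (X b \<in> A \<inter> B)) (int m) * slice_sum (int m) w ?I (\<lambda>_. 1) (int m)
      \<le> slice_sum (int m) w ?I (\<lambda>b. of_bool (X b \<in> A)) (int m) *
         slice_sum (int m) w ?I (\<lambda>b. of_bool (X b \<in> B)) (int m)"
      unfolding X_def
    proof (rule threshold_negative_association[OF T(3) \<theta> lcw _ A B AB])
      show "w j b = 0" if "b \<notin> {0..int m}" for j b using that by (auto simp: w_def G_def)
    qed
    then have "measure \<mu> (E \<inter> (A \<inter> B)) * measure \<mu> E \<le> measure \<mu> (E \<inter> A) * measure \<mu> (E \<inter> B)"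
      unfolding \<mu>EF \<mu>E' by (simp add: mult_ac)
    then show "measure \<mu> ({x\<in>?\<Omega>. \<forall>j\<in>J. x j = v j} \<inter> (A \<inter> B)) * measure \<mu> {x\<in>?\<Omega>. \<forall>j\<in>J. x j = v j}
      \<le> measure \<mu> ({x\<in>?\<Omega>. \<forall>j\<in>J. x j = v j} \<inter> A) * measure \<mu> ({x\<in>?\<Omega>. \<forall>j\<in>J. x j = v j} \<inter> B)"
      unfolding E_def .
  qed
  then show ?thesis by (simp add: \<mu>_def \<xi>_def[abs_def])
qed

end
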